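(* There are constants $C,C',C''>0$ such that for every sufficiently large $n$ there is a triangle-free graph on $n$ vertices with all degrees between $C'n^{1/3}$ and $C''n^{1/3}$ that contains no semi-bipartite induced subgraph of average degree (with respect to its semi-bipartition) at least $C\log n$.
   Context: $\log$ is the natural logarithm. Given a graph $G$, an induced subgraph $G'$ of $G$ with vertex set $V'$ is semi-bipartite if it admits a partition $V'=V_1\cup V_2$ such that $V_1$ is a stable set of $G$; its average degree with respect to this semi-bipartition is the average degree of the bipartite graph on $V_1\cup V_2$ formed by the edges of $G$ between $V_1$ and $V_2$ (edges inside $V_2$ are ignored). A semi-bipartite induced subgraph of average degree at least $x$ means one admitting some semi-bipartition with respect to which its average degree is at least $x$. *)

theory Defs
  imports Complex_Main "Graph_Theory.Digraph_Component"
begin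

text \<open>
  Finite simple graphs are the symmetric, loop-free digraphs without parallel arcs of
  Graph_Theory (\<^locale>\<open>pair_graph\<close>); an undirected edge is a pair of opposite arcs, so the
  degree of a vertex is its \<^const>\<open>out_degree\<close>.
\<close>

definition triangle_free :: "('a, 'b) pre_digraph \<Rightarrow> bool" where
  "triangle_free G \<longleftrightarrow>
     \<not> (\<exists>u v w. u \<rightarrow>\<^bsub>G\<^esub> v \<and> v \<rightarrow>\<^bsub>G\<^esub> w \<and> w \<rightarrow>\<^bsub>G\<^esub> u)"

definition stable_set :: "('a, 'b) pre_digraph \<Rightarrow> 'a set \<Rightarrow> bool" where
  "stable_set G S \<longleftrightarrow> S \<subseteq> verts G \<and> (\<forall>u\<in>S. \<forall>v\<in>S. \<not> u \<rightarrow>\<^bsub>G\<^esub> v)"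

definition semi_bipartition ::
  "('a, 'b) pre_digraph \<Rightarrow> ('a, 'b) pre_digraph \<Rightarrow> 'a set \<Rightarrow> 'a set \<Rightarrow> bool" where
  "semi_bipartition G H V1 V2 \<longleftrightarrow>
     verts H = V1 \<union> V2 \<and> V1 \<inter> V2 = {} \<and> stable_set G V1"

definition bipartite_between ::
  "('a, 'b) pre_digraph \<Rightarrow> 'a set \<Rightarrow> 'a set \<Rightarrow> 'a pair_pre_digraph" where
  "bipartite_between G V1 V2 =
     \<lparr> pverts = V1 \<union> V2,
       parcs = {(u, v). u \<rightarrow>\<^bsub>G\<^esub> v \<and> (u \<in> V1 \<and> v \<in> V2 \<or> u \<in> V2 \<and> v \<in> V1)} \<rparr>"

text \<open>The graph without vertices gets average degree \<open>0\<close>, as \<open>0 / 0 = 0\<close>.\<close>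

definition average_degree :: "('a, 'b) pre_digraph \<Rightarrow> real" where
  "average_degree G = (\<Sum>v\<in>verts G. real (out_degree G v)) / real (card (verts G))"

definition has_semi_bipartite_induced_subgraph ::
  "('a, 'b) pre_digraph \<Rightarrow> real \<Rightarrow> bool" where
  "has_semi_bipartite_induced_subgraph G x \<longleftrightarrow>
     (\<exists>H V1 V2. induced_subgraph H G \<and> semi_bipartition G H V1 V2 \<and>
        average_degree (with_proj (bipartite_between G V1 V2)) \<ge> x)"

end

theory Submission
  imports Defs "HOL-Probability.Product_PMF" "HOL-Real_Asymp.Real_Asymp"
begin

text \<open>
  Let \<open>r = n powr (1/3)\<close> and take a random graph on \<open>n\<close> vertices with edge probability
  \<open>p = 1 / (4 * r^2)\<close>. With overwhelming probability all degrees are at most \<open>2 * r\<close>, every stable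
  set has fewer than \<open>9 * ln n / p\<close> vertices, and between any set \<open>A\<close> of at most that size and any
  disjoint set \<open>B\<close> there are at most \<open>72 * ln n * (card A + card B)\<close> edges. Since the expected number
  of edges minus \<open>2 * r\<close> times the number of triangles is of order \<open>r^4\<close>, some such graph still has
  order \<open>r^4\<close> edges after one vertex of each triangle is deleted. Passing to an induced subgraph of
  large minimum degree keeps a positive fraction of the vertices, because the maximum degree is
  \<open>O(r)\<close>; stability and the edge bounds are inherited by induced subgraphs. Finally, replacing each
  vertex by boundedly many twins restores exactly \<open>n\<close> vertices and changes all quantities only by
  constant factors.
\<close>

section \<open>Undirected graphs as sets of two-element vertex sets\<close>

definition pairs :: "'a set \<Rightarrow> 'a set set" where
  "pairs V = {e. e \<subseteq> V \<and> card e = 2}"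

definition triangles :: "'a set \<Rightarrow> 'a set set \<Rightarrow> 'a set set" where
  "triangles V F = {t. t \<subseteq> V \<and> card t = 3 \<and> pairs t \<subseteq> F}"

definition stable_in :: "'a set set \<Rightarrow> 'a set \<Rightarrow> bool" where
  "stable_in F A \<longleftrightarrow> pairs A \<inter> F = {}"

text \<open>Ordered pairs are used so that, for disjoint \<open>A\<close> and \<open>B\<close>, each
  edge between them is counted exactly once.\<close>

definition cross_edges :: "'a set set \<Rightarrow> 'a set \<Rightarrow> 'a set \<Rightarrow> ('a \<times> 'a) set" where
  "cross_edges F A B = {(a, b) \<in> A \<times> B. {a, b} \<in> F}"

lemma finite_pairs: "finite V \<Longrightarrow> finite (pairs V)"
  by (rule finite_subset[of _ "Pow V"]) (auto simp: pairs_def)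

lemma card_pairs: "finite V \<Longrightarrow> card (pairs V) = card V choose 2"
  unfolding pairs_def by (rule n_subsets)

lemma pairs_mono: "A \<subseteq> B \<Longrightarrow> pairs A \<subseteq> pairs B"
  by (auto simp: pairs_def)

lemma doubleton_in_pairs_iff: "{u, v} \<in> pairs V \<longleftrightarrow> u \<in> V \<and> v \<in> V \<and> u \<noteq> v"
  by (auto simp: pairs_def card_2_iff doubleton_eq_iff)

lemma edge_endpoints: "F \<subseteq> pairs V \<Longrightarrow> {u, v} \<in> F \<Longrightarrow> u \<in> V \<and> v \<in> V \<and> u \<noteq> v"
  by (simp add: subset_iff flip: doubleton_in_pairs_iff)

subsection \<open>Random subsets of a finite set\<close>

text \<open>A random subset is represented by its indicator function, \<open>False\<close> outside
  \<open>E\<close>. With \<open>E = pairs V\<close> the random graph is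
  \<open>{e \<in> pairs V. w e}\<close>.\<close>

abbreviation bernoulli_subset :: "'a set \<Rightarrow> real \<Rightarrow> ('a \<Rightarrow> bool) pmf" where
  "bernoulli_subset E p \<equiv> Pi_pmf E False (\<lambda>_. bernoulli_pmf p)"

lemma finite_set_bernoulli_subset: "finite E \<Longrightarrow> finite (set_pmf (bernoulli_subset E p))"
  by (subst set_Pi_pmf) (auto intro!: finite_PiE_dflt)

lemma prob_all_present:
  assumes "finite E" "S \<subseteq> E" "0 \<le> p" "p \<le> 1"
  shows "measure_pmf.prob (bernoulli_subset E p) {w. \<forall>e\<in>S. w e} = p ^ card S"
proof -
  have *: "{w. \<forall>e\<in>S. w e} = Pi E (\<lambda>e. if e \<in> S then {True} else UNIV)"
    using assms by (auto simp: Pi_def)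
  have "(\<Prod>e\<in>E. measure_pmf.prob (bernoulli_pmf p) (if e \<in> S then {True} else UNIV)) =
        (\<Prod>e\<in>E. if e \<in> S then p else 1)"
    using assms by (intro prod.cong) (auto simp: measure_pmf_single)
  also have "\<dots> = p ^ card S"
    using assms by (simp add: prod.If_cases Int_absorb1)
  finally show ?thesis
    unfolding * by (subst measure_Pi_pmf_Pi) (use assms in auto)
qed

lemma prob_none_present_le:
  assumes "finite E" "S \<subseteq> E" "0 \<le> p" "p \<le> 1"
  shows "measure_pmf.prob (bernoulli_subset E p) {w. \<forall>e\<in>S. \<not> w e} \<le> exp (- p * card S)"
proof -
  have *: "{w. \<forall>e\<in>S. \<not> w e} = Pi E (\<lambda>e. if e \<in> S then {False} else UNIV)"
    using assms by (auto simp: Pi_def)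
  have "(\<Prod>e\<in>E. measure_pmf.prob (bernoulli_pmf p) (if e \<in> S then {False} else UNIV)) =
        (\<Prod>e\<in>E. if e \<in> S then 1 - p else 1)"
    using assms by (intro prod.cong) (auto simp: measure_pmf_single)
  also have "\<dots> = (1 - p) ^ card S"
    using assms by (simp add: prod.If_cases Int_absorb1)
  also have "\<dots> \<le> exp (- p) ^ card S"
    using assms exp_ge_add_one_self[of "- p"] by (intro power_mono) auto
  also have "\<dots> = exp (- p * card S)"
    by (simp add: exp_of_nat_mult[symmetric] mult.commute)
  finally show ?thesis
    unfolding * by (subst measure_Pi_pmf_Pi) (use assms in auto)
qed

text \<open>Markov's inequality for \<open>exp (2 * X)\<close>, where \<open>X\<close> is the number of present elements.\<close>

lemma prob_card_ge_le:
  fixes x :: real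
  assumes "finite E" "S \<subseteq> E" "0 \<le> p" "p \<le> 1"
    and x: "exp 2 * p * card S \<le> x"
  shows "measure_pmf.prob (bernoulli_subset E p) {w. x \<le> card {e \<in> S. w e}} \<le> exp (- x)"
proof -
  let ?M = "bernoulli_subset E p"
  let ?f = "\<lambda>w. exp (2 * real (card {e \<in> S. w e}))"
  have f: "?f w = (\<Prod>e\<in>E. if e \<in> S \<and> w e then exp 2 else 1)" for w
  proof -
    have "(\<Prod>e\<in>E. if e \<in> S \<and> w e then exp 2 else 1) = exp (2::real) ^ card {e \<in> E. e \<in> S \<and> w e}"
      using assms by (simp add: prod.If_cases Int_def)
    also have "{e \<in> E. e \<in> S \<and> w e} = {e \<in> S. w e}"
      using assms by auto
    finally show ?thesis
      by (simp add: exp_of_nat_mult[symmetric] mult.commute)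
  qed
  have "measure_pmf.expectation ?M ?f =
        (\<Prod>e\<in>E. measure_pmf.expectation (bernoulli_pmf p) (\<lambda>b. if e \<in> S \<and> b then exp 2 else 1))"
    unfolding f
    by (subst expectation_prod_Pi_pmf) (use assms in \<open>auto intro: integrable_measure_pmf_finite\<close>)
  also have "\<dots> = (\<Prod>e\<in>E. if e \<in> S then 1 + p * (exp 2 - 1) else 1)"
    using assms by (intro prod.cong) (auto simp: algebra_simps)
  also have "\<dots> = (1 + p * (exp 2 - 1)) ^ card S"
    using assms by (simp add: prod.If_cases Int_absorb1)
  also have "\<dots> \<le> exp (p * (exp 2 - 1)) ^ card S"
    using assms by (intro power_mono) (auto intro!: add_nonneg_nonneg mult_nonneg_nonneg)
  also have "\<dots> = exp (p * (exp 2 - 1) * card S)"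
    by (simp add: exp_of_nat_mult[symmetric] mult.commute)
  \<comment> \<open>Dropping the \<open>- 1\<close> reduces this to the hypothesis on
    \<open>x\<close>. The moment is thus at most \<open>exp x\<close>, and dividing by
    \<open>exp (2 * x)\<close> leaves \<open>exp (- x)\<close>.\<close>
  also have "\<dots> \<le> exp x"
    unfolding exp_le_cancel_iff using assms by (intro order_trans[OF _ x]) (simp add: algebra_simps)
  finally have E: "measure_pmf.expectation ?M ?f \<le> exp x" .
  have "{w. x \<le> card {e \<in> S. w e}} = {w. exp (2 * x) \<le> ?f w}"
    by auto
  then have "measure_pmf.prob ?M {w. x \<le> card {e \<in> S. w e}} = measure_pmf.prob ?M {w. exp (2 * x) \<le> ?f w}"
    by simp
  also have "\<dots> \<le> measure_pmf.expectation ?M ?f / exp (2 * x)"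
    using integral_Markov_inequality_measure[of ?M ?f "{}" "exp (2 * x)"]
    by (simp add: integrable_measure_pmf_finite finite_set_bernoulli_subset assms)
  also have "\<dots> \<le> exp x / exp (2 * x)"
    using E by (simp add: divide_right_mono)
  also have "\<dots> = exp (- x)"
    by (simp flip: exp_diff)
  finally show ?thesis .
qed

lemma expectation_card:
  assumes "finite T"
  shows "measure_pmf.expectation M (\<lambda>w. real (card {s \<in> T. Q s w})) =
         (\<Sum>s\<in>T. measure_pmf.prob M {w. Q s w})"
proof -
  have "real (card {s \<in> T. Q s w}) = (\<Sum>s\<in>T. indicator {w. Q s w} w)" for w
    using assms by (simp add: indicator_def sum.If_cases Int_def)
  then show ?thesis
    by (simp add: measure_pmf.emeasure_eq_measure)
qed

text \<open>Subset form of the binomial theorem: the subsets of \<open>insert v V\<close> are split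
  according to whether they contain \<open>v\<close>.\<close>

lemma sum_power_card_Pow:
  fixes x :: "'b::comm_semiring_1"
  assumes "finite V"
  shows "(\<Sum>A\<in>Pow V. x ^ card A) = (1 + x) ^ card V"
  using assms
proof (induction V rule: finite_induct)
  case (insert v V)
  have "(\<Sum>A\<in>Pow (insert v V). x ^ card A) =
        (\<Sum>A\<in>Pow V. x ^ card A) + (\<Sum>A\<in>insert v ` Pow V. x ^ card A)"
    unfolding Pow_insert using insert.hyps by (intro sum.union_disjoint) auto
  also have "(\<Sum>A\<in>insert v ` Pow V. x ^ card A) = (\<Sum>A\<in>Pow V. x ^ card (insert v A))"
    by (intro sum.reindex_cong[of "insert v"] inj_onI) (use insert.hyps in auto)
  also have "\<dots> = (\<Sum>A\<in>Pow V. x * x ^ card A)"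
    using insert.hyps by (intro sum.cong refl, subst card_insert_disjoint) (auto intro: finite_subset)
  finally show ?case
    using insert by (simp add: sum_distrib_left[symmetric] algebra_simps)
qed auto

text \<open>With \<open>n = card V > 0\<close>, each weight is at most
  \<open>(1 / n) ^ card A\<close>, and these sum to \<open>(1 + 1 / n) ^ n \<le> exp 1\<close>. This
  pays for a union bound over all vertex sets.\<close>

lemma sum_exp_card_Pow_le:
  assumes "finite V" "c \<ge> 1"
  shows "(\<Sum>A\<in>Pow V. exp (- c * ln (card V) * card A)) \<le> 3"
proof (cases "card V = 0")
  case True
  then show ?thesis using assms by auto
next
  case False
  define n where "n = card V"
  have n: "n > 0" using False by (simp add: n_def)
  have "(\<Sum>A\<in>Pow V. exp (- c * ln n * card A)) \<le> (\<Sum>A\<in>Pow V. (1 / n) ^ card A)"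
  proof (intro sum_mono)
    fix A
    have "exp (- c * ln n * card A) \<le> exp (- 1 * ln n * card A)"
      unfolding exp_le_cancel_iff using n assms by (intro mult_right_mono) auto
    also have "\<dots> = exp (- ln n) ^ card A"
      by (simp add: exp_of_nat_mult[symmetric] mult.commute)
    also have "exp (- ln n) = 1 / real n"
      using n by (simp add: exp_minus field_simps)
    finally show "exp (- c * ln n * card A) \<le> (1 / n) ^ card A" .
  qed
  also have "\<dots> = (1 + 1 / n) ^ n"
    using assms by (simp add: sum_power_card_Pow n_def)
  also have "\<dots> \<le> exp (1 / n) ^ n"
    by (intro power_mono) auto
  also have "\<dots> = exp 1"
    using n by (simp add: exp_of_nat_mult[symmetric])
  also have "\<dots> \<le> 3" by (rule exp_le)
  finally show ?thesis by (simp add: n_def)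
qed

text \<open>Since \<open>card A \<ge> 1\<close>, the surplus exponent \<open>d\<close> yields an
  extra factor that decays with \<open>card V\<close>, so the union bound becomes small and not
  merely bounded.\<close>

lemma sum_exp_card_nonempty_le:
  assumes "finite V" "c \<ge> 1" "d \<ge> 0"
  shows "(\<Sum>A\<in>Pow V - {{}}. exp (- (c + d) * ln (card V) * card A)) \<le> 3 * exp (- d * ln (card V))"
proof -
  let ?L = "ln (real (card V))"
  \<comment> \<open>For empty \<open>V\<close> this rests on the convention
    \<open>ln 0 = 0\<close>.\<close>
  have L: "?L \<ge> 0" by (cases "card V") auto
  have "(\<Sum>A\<in>Pow V - {{}}. exp (- (c + d) * ?L * card A))
      \<le> (\<Sum>A\<in>Pow V - {{}}. exp (- c * ?L * card A) * exp (- d * ?L))"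
  proof (intro sum_mono)
    fix A assume "A \<in> Pow V - {{}}"
    then have "card A \<ge> 1" using assms finite_subset
      by (metis Diff_iff One_nat_def PowD Suc_leI card_gt_0_iff insertI1)
    then have "d * ?L * 1 \<le> d * ?L * card A"
      using L assms by (intro mult_left_mono) auto
    then show "exp (- (c + d) * ?L * card A) \<le> exp (- c * ?L * card A) * exp (- d * ?L)"
      unfolding exp_add[symmetric] exp_le_cancel_iff by (simp add: algebra_simps)
  qed
  also have "\<dots> \<le> (\<Sum>A\<in>Pow V. exp (- c * ?L * card A) * exp (- d * ?L))"
    using assms by (intro sum_mono2) auto
  also have "\<dots> \<le> 3 * exp (- d * ?L)"
    unfolding sum_distrib_right[symmetric] using sum_exp_card_Pow_le[OF assms(1,2)]
    by (intro mult_right_mono) auto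
  finally show ?thesis .
qed

subsection \<open>Bad events in the random graph\<close>

text \<open>Turns the factor \<open>exp 2\<close> in the hypothesis of
  \<open>prob_card_ge_le\<close> into an integer.\<close>

lemma exp_2_le_8: "exp 2 \<le> (8::real)"
proof -
  have "exp (1::real) < 272 / 100"
    by (rule e_less_272)
  then have "exp (1::real) ^ 2 \<le> (272 / 100) ^ 2"
    by (intro power_mono) auto
  then show ?thesis
    by (simp add: exp_of_nat_mult[symmetric] power2_eq_square flip: exp_add)
qed

text \<open>The map from \<open>u\<close> to \<open>{u, v}\<close> is a bijection. It turns degrees
  into counts of present elements of a fixed set of pairs, the form needed for
  \<open>prob_card_ge_le\<close>.\<close>

lemma card_neighbours_eq:
  assumes "F \<subseteq> pairs V"
  shows "card {u. {u, v} \<in> F} = card {e \<in> F. v \<in> e}"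
proof (rule bij_betw_same_card[of "\<lambda>u. {u, v}"], unfold bij_betw_def, intro conjI inj_onI set_eqI iffI)
  fix e assume "e \<in> {e \<in> F. v \<in> e}"
  then obtain u where "e = {u, v}"
    using assms by (auto simp: pairs_def card_2_iff)
  then show "e \<in> (\<lambda>u. {u, v}) ` {u. {u, v} \<in> F}"
    using \<open>e \<in> {e \<in> F. v \<in> e}\<close> by auto
qed (auto simp: doubleton_eq_iff)

lemma card_star_le:
  assumes "finite V"
  shows "card {e \<in> pairs V. v \<in> e} \<le> card V"
proof -
  have "card {e \<in> pairs V. v \<in> e} = card {u. {u, v} \<in> pairs V}"
    by (rule card_neighbours_eq[symmetric, where V=V]) simp
  also have "\<dots> \<le> card V"
    using assms by (intro card_mono) (auto simp: doubleton_in_pairs_iff)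
  finally show ?thesis .
qed

text \<open>Disjointness makes forgetting the order of a pair injective on
  \<open>A \<times> B\<close>.\<close>

lemma card_cross_edges_eq:
  assumes "A \<inter> B = {}"
  shows "card (cross_edges F A B) = card {e \<in> (\<lambda>(a, b). {a, b}) ` (A \<times> B). e \<in> F}"
  by (rule bij_betw_same_card[of "\<lambda>(a, b). {a, b}"])
     (use assms in \<open>auto simp: bij_betw_def inj_on_def cross_edges_def doubleton_eq_iff\<close>)

text \<open>The expected degree is at most \<open>p * card V \<le> r / 4\<close>, and 8 times this
  is the threshold \<open>2 * r\<close>.\<close>

lemma prob_large_degree_le:
  fixes p r :: real
  assumes "finite V" "0 \<le> p" "p \<le> 1" "4 * p * card V \<le> r"
  shows "measure_pmf.prob (bernoulli_subset (pairs V) p)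
           {w. 2 * r \<le> card {e \<in> {e \<in> pairs V. v \<in> e}. w e}} \<le> exp (- 2 * r)"
proof -
  have "exp 2 * (p * card {e \<in> pairs V. v \<in> e}) \<le> 8 * (p * card V)"
    using assms exp_2_le_8 card_star_le[of V v] by (intro mult_mono mult_nonneg_nonneg) auto
  then show ?thesis
    using prob_card_ge_le[of "pairs V" "{e \<in> pairs V. v \<in> e}" p "2 * r"] assms
    by (simp add: finite_pairs mult.assoc)
qed

text \<open>From \<open>9 * L \<le> p * card A\<close> and \<open>p \<le> 1 \<le> L\<close> follows
  \<open>8 * L \<le> p * (card A - 1)\<close>. Hence the expected number of edges inside
  \<open>A\<close> is at least \<open>4 * L * card A\<close>, enough to beat the number of sets
  \<open>A\<close>.\<close>

lemma prob_stable_le: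
  fixes p L :: real
  assumes "finite V" "0 < p" "p \<le> 1" "1 \<le> L" "A \<subseteq> V" "9 * L / p \<le> card A"
  shows "measure_pmf.prob (bernoulli_subset (pairs V) p) {w. \<forall>e\<in>pairs A. \<not> w e}
           \<le> exp (- 4 * L * card A)"
proof -
  have finA: "finite A" using assms finite_subset by blast
  have c: "real (card A choose 2) = real (card A) * (real (card A) - 1) / 2"
    by (cases "card A") (auto simp: choose_two real_of_nat_div algebra_simps)
  have "8 * L \<le> p * (real (card A) - 1)"
    using assms by (simp add: field_simps)
  then have "8 * L * card A \<le> p * (real (card A) - 1) * card A"
    by (intro mult_right_mono) auto
  then have *: "4 * L * card A \<le> p * card (pairs A)"
    by (simp add: card_pairs[OF finA] c algebra_simps)
  have "measure_pmf.prob (bernoulli_subset (pairs V) p) {w. \<forall>e\<in>pairs A. \<not> w e}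
        \<le> exp (- p * card (pairs A))"
    using assms by (intro prob_none_present_le) (auto simp: finite_pairs pairs_mono)
  also have "\<dots> \<le> exp (- 4 * L * card A)"
    using * by simp
  finally show ?thesis .
qed

text \<open>The size bound on \<open>A\<close> keeps the expected number of cross edges below
  \<open>9 * L * card B\<close>, and 8 times this is at most the threshold. The bound is a product
  so that it can be summed over \<open>A\<close> and \<open>B\<close> separately.\<close>

lemma prob_many_cross_edges_le:
  fixes p L :: real
  assumes "finite V" "0 < p" "p \<le> 1" "0 \<le> L" "A \<subseteq> V" "B \<subseteq> V" "A \<inter> B = {}"
    "card A \<le> 9 * L / p"
  shows "measure_pmf.prob (bernoulli_subset (pairs V) p)
           {w. 72 * L * (card A + card B) \<le> card {e \<in> (\<lambda>(a, b). {a, b}) ` (A \<times> B). w e}}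
         \<le> exp (- 72 * L * card A) * exp (- 72 * L * card B)"
proof -
  let ?S = "(\<lambda>(a, b). {a, b}) ` (A \<times> B)"
  have fin: "finite A" "finite B" using assms finite_subset by blast+
  have "real (card ?S) \<le> card A * card B"
    using card_image_le[of "A \<times> B" "\<lambda>(a, b). {a, b}"] fin
    by (simp add: card_cartesian_product flip: of_nat_mult)
  then have "p * card ?S \<le> p * (card A * card B)"
    using assms by (intro mult_left_mono) auto
  also have "\<dots> = (p * card A) * card B" by simp
  also have "\<dots> \<le> (9 * L) * card B"
    using assms by (intro mult_right_mono) (auto simp: field_simps)
  also have "\<dots> \<le> 9 * L * (card A + card B)"
    using assms by (intro mult_left_mono) auto
  finally have "exp 2 * (p * card ?S) \<le> 8 * (9 * L * (card A + card B))"
    using assms by (intro mult_mono[OF exp_2_le_8]) auto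
  then have "measure_pmf.prob (bernoulli_subset (pairs V) p)
        {w. 72 * L * (card A + card B) \<le> card {e \<in> ?S. w e}} \<le> exp (- (72 * L * (card A + card B)))"
    using assms by (intro prob_card_ge_le) (auto simp: finite_pairs doubleton_in_pairs_iff)
  then show ?thesis
    by (simp add: algebra_simps flip: exp_add)
qed

text \<open>Twice the number of cross edges divided by \<open>card A + card B\<close> is an average
  degree, so this bounds every semi-bipartite average degree by \<open>2 * c\<close>.\<close>

definition sparse_cross :: "real \<Rightarrow> 'a set \<Rightarrow> 'a set set \<Rightarrow> bool" where
  "sparse_cross c V F \<longleftrightarrow> (\<forall>A B. A \<subseteq> V \<longrightarrow> B \<subseteq> V \<longrightarrow> A \<inter> B = {} \<longrightarrow> stable_in F A \<longrightarrow>
     real (card (cross_edges F A B)) \<le> c * (card A + card B))"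

text \<open>A union bound over three kinds of events: large degrees, large stable sets, and too many
  edges between a small set and any other set. A stable set is either large, which is unlikely in
  itself, or small, and then its stability can be ignored.\<close>

lemma prob_bad_le:
  fixes V :: "'a set" and p r :: real
  defines "L \<equiv> ln (real (card V))"
  assumes V: "finite V" and p: "0 < p" "p \<le> 1" "4 * p * card V \<le> r" and L: "1 \<le> L"
  shows "measure_pmf.prob (bernoulli_subset (pairs V) p)
           {w. \<not> ((\<forall>v\<in>V. real (card {u. {u, v} \<in> {e \<in> pairs V. w e}}) \<le> 2 * r) \<and>
                  sparse_cross (72 * L) V {e \<in> pairs V. w e})}
         \<le> card V * exp (- 2 * r) + (3 * exp (- 3 * L) + 9 * exp (- 71 * L))"
proof -
  let ?M = "bernoulli_subset (pairs V) p"
  let ?P = "measure_pmf.prob ?M"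
  let ?S = "\<lambda>A B. (\<lambda>(a, b). {a, b}) ` (A \<times> B)"
  let ?N = "Pow V - {{}}"
  define D where "D v = {w. 2 * r \<le> card {e \<in> {e \<in> pairs V. v \<in> e}. w e}}" for v :: 'a
  \<comment> \<open>Conditions not involving \<open>w\<close> are placed inside the events, which
    become empty when they fail; the sums can then run over all sets.\<close>
  define I where "I A = {w. 9 * L / p \<le> card A \<and> (\<forall>e\<in>pairs A. \<not> w e)}" for A :: "'a set"
  define X where "X A B = {w. A \<inter> B = {} \<and> card A \<le> 9 * L / p \<and>
    72 * L * (card A + card B) \<le> card {e \<in> ?S A B. w e}}" for A B :: "'a set"
  have finN: "finite ?N" using V by simp
  have sub: "{w. \<not> ((\<forall>v\<in>V. real (card {u. {u, v} \<in> {e \<in> pairs V. w e}}) \<le> 2 * r) \<and>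
                  sparse_cross (72 * L) V {e \<in> pairs V. w e})}
      \<subseteq> (\<Union>v\<in>V. D v) \<union> ((\<Union>A\<in>?N. I A) \<union> (\<Union>(A, B)\<in>?N \<times> Pow V. X A B))"
  proof
    fix w
    let ?F = "{e \<in> pairs V. w e}"
    assume "w \<in> {w. \<not> ((\<forall>v\<in>V. real (card {u. {u, v} \<in> {e \<in> pairs V. w e}}) \<le> 2 * r) \<and>
                  sparse_cross (72 * L) V {e \<in> pairs V. w e})}"
    then consider v where "v \<in> V" "2 * r < card {u. {u, v} \<in> ?F}"
      | A B where "A \<subseteq> V" "B \<subseteq> V" "A \<inter> B = {}" "stable_in ?F A"
          "72 * L * (card A + card B) < card (cross_edges ?F A B)"
      unfolding sparse_cross_def by (auto simp: not_le)
    then show "w \<in> (\<Union>v\<in>V. D v) \<union> ((\<Union>A\<in>?N. I A) \<union> (\<Union>(A, B)\<in>?N \<times> Pow V. X A B))"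
    proof cases
      case 1
      have "card {u. {u, v} \<in> ?F} = card {e \<in> ?F. v \<in> e}"
        by (rule card_neighbours_eq) auto
      also have "{e \<in> ?F. v \<in> e} = {e \<in> {e \<in> pairs V. v \<in> e}. w e}"
        by auto
      finally have "w \<in> D v"
        using 1 by (simp add: D_def)
      then show ?thesis using 1 by blast
    next
      case 2
      \<comment> \<open>A violated bound forces a cross edge, so \<open>A\<close> is nonempty; the
        decay in the sums over \<open>?N\<close> depends on this.\<close>
      have "card (cross_edges ?F A B) > 0"
        using 2 L by (smt (verit) mult_nonneg_nonneg of_nat_0_le_iff of_nat_0_less_iff)
      then have A: "A \<in> ?N"
        using 2 by (auto simp: cross_edges_def)
      show ?thesis
      proof (cases "9 * L / p \<le> card A")
        case True
        have "\<forall>e\<in>pairs A. \<not> w e"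
          using 2 pairs_mono[of A V] by (auto simp: stable_in_def)
        then show ?thesis using A True by (auto simp: I_def)
      next
        case False
        have "?S A B \<subseteq> pairs V"
          using 2 by (auto simp: doubleton_in_pairs_iff)
        then have "{e \<in> ?S A B. e \<in> ?F} = {e \<in> ?S A B. w e}"
          by auto
        then have "card (cross_edges ?F A B) = card {e \<in> ?S A B. w e}"
          using card_cross_edges_eq[OF 2(3), of ?F] by simp
        then have "w \<in> X A B"
          using 2 False by (auto simp: X_def)
        then show ?thesis using A 2 by blast
      qed
    qed
  qed
  have "?P (\<Union>v\<in>V. D v) \<le> (\<Sum>v\<in>V. ?P (D v))"
    using V by (intro measure_pmf.finite_measure_subadditive_finite) auto
  also have "\<dots> \<le> (\<Sum>v\<in>V. exp (- 2 * r))"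
    unfolding D_def using V p by (intro sum_mono prob_large_degree_le) auto
  finally have PD: "?P (\<Union>v\<in>V. D v) \<le> card V * exp (- 2 * r)" by simp
  have "?P (\<Union>A\<in>?N. I A) \<le> (\<Sum>A\<in>?N. ?P (I A))"
    using finN by (intro measure_pmf.finite_measure_subadditive_finite) auto
  \<comment> \<open>Of the exponent 4, one unit pays for the sum over \<open>A\<close> and three
    remain as decay.\<close>
  also have "\<dots> \<le> (\<Sum>A\<in>?N. exp (- (1 + 3) * ln (real (card V)) * card A))"
  proof (intro sum_mono)
    fix A assume "A \<in> ?N"
    then show "?P (I A) \<le> exp (- (1 + 3) * ln (real (card V)) * card A)"
      using prob_stable_le[OF V p(1,2) L, of A]
      by (cases "9 * L / p \<le> card A") (auto simp: I_def L_def)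
  qed
  also have "\<dots> \<le> 3 * exp (- 3 * L)"
    unfolding L_def using V by (intro sum_exp_card_nonempty_le) auto
  finally have PI: "?P (\<Union>A\<in>?N. I A) \<le> 3 * exp (- 3 * L)" .
  have "?P (\<Union>(A, B)\<in>?N \<times> Pow V. X A B) \<le> (\<Sum>(A, B)\<in>?N \<times> Pow V. ?P (X A B))"
    using measure_pmf.finite_measure_subadditive_finite[of "?N \<times> Pow V" "\<lambda>(A, B). X A B" ?M] finN V
    by (simp add: case_prod_unfold)
  \<comment> \<open>The set \<open>B\<close> may be empty, so its sum is only bounded by 3; the
    decay comes from the 71 surplus units for \<open>A\<close>.\<close>
  also have "\<dots> \<le> (\<Sum>(A, B)\<in>?N \<times> Pow V.
      exp (- (1 + 71) * ln (real (card V)) * card A) * exp (- 72 * ln (real (card V)) * card B))"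
  proof (intro sum_mono)
    fix z assume "z \<in> ?N \<times> Pow V"
    then obtain A B where z: "z = (A, B)" "A \<subseteq> V" "B \<subseteq> V" by auto
    have "?P (X A B) \<le> exp (- (1 + 71) * ln (real (card V)) * card A) * exp (- 72 * ln (real (card V)) * card B)"
    proof (cases "A \<inter> B = {} \<and> card A \<le> 9 * L / p")
      case True
      then show ?thesis
        using prob_many_cross_edges_le[OF V p(1,2), of L A B] L z
        by (simp add: X_def L_def)
    next
      case False
      then have "X A B = {}" unfolding X_def by blast
      then show ?thesis by simp
    qed
    then show "(case z of (A, B) \<Rightarrow> ?P (X A B)) \<le> (case z of (A, B) \<Rightarrow>
        exp (- (1 + 71) * ln (real (card V)) * card A) * exp (- 72 * ln (real (card V)) * card B))"
      by (simp add: z)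
  qed
  also have "\<dots> = (\<Sum>A\<in>?N. exp (- (1 + 71) * ln (real (card V)) * card A)) *
      (\<Sum>B\<in>Pow V. exp (- 72 * ln (real (card V)) * card B))"
    by (simp add: sum_product sum.cartesian_product)
  also have "\<dots> \<le> (3 * exp (- 71 * ln (real (card V)))) * 3"
    using V by (intro mult_mono sum_exp_card_nonempty_le sum_exp_card_Pow_le sum_nonneg) auto
  finally have PX: "?P (\<Union>(A, B)\<in>?N \<times> Pow V. X A B) \<le> 9 * exp (- 71 * L)"
    by (simp add: L_def)
  have "?P ((\<Union>v\<in>V. D v) \<union> ((\<Union>A\<in>?N. I A) \<union> (\<Union>(A, B)\<in>?N \<times> Pow V. X A B)))
      \<le> ?P (\<Union>v\<in>V. D v) + (?P (\<Union>A\<in>?N. I A) + ?P (\<Union>(A, B)\<in>?N \<times> Pow V. X A B))"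
    by (intro order_trans[OF measure_Un_le] add_mono measure_Un_le) auto
  also have "\<dots> \<le> card V * exp (- 2 * r) + (3 * exp (- 3 * L) + 9 * exp (- 71 * L))"
    using PD PI PX by linarith
  finally show ?thesis
    using measure_pmf.finite_measure_mono[OF sub, of ?M] by simp
qed

section \<open>Expected number of edges against triangles\<close>

lemma expectation_edges_minus_triangles:
  fixes p c :: real
  assumes "finite V" "0 \<le> p" "p \<le> 1"
  shows "measure_pmf.expectation (bernoulli_subset (pairs V) p)
      (\<lambda>w. card {e \<in> pairs V. w e} - c * card (triangles V {e \<in> pairs V. w e})) =
    (card V choose 2) * p - c * ((card V choose 3) * p ^ 3)"
proof -
  let ?M = "bernoulli_subset (pairs V) p"
  let ?T = "{t. t \<subseteq> V \<and> card t = 3}"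
  have int: "integrable ?M f" for f :: "_ \<Rightarrow> real"
    using assms by (intro integrable_measure_pmf_finite finite_set_bernoulli_subset finite_pairs)
  have "measure_pmf.expectation ?M (\<lambda>w. real (card {e \<in> pairs V. w e})) =
      (\<Sum>e\<in>pairs V. measure_pmf.prob ?M {w. w e})"
    using assms by (intro expectation_card finite_pairs)
  also have "\<dots> = (\<Sum>e\<in>pairs V. p)"
    using prob_all_present[of "pairs V" "{e}" p for e] assms by (intro sum.cong) (auto simp: finite_pairs)
  finally have edges: "measure_pmf.expectation ?M (\<lambda>w. real (card {e \<in> pairs V. w e})) = (card V choose 2) * p"
    using assms by (simp add: card_pairs)
  have T: "triangles V {e \<in> pairs V. w e} = {t \<in> ?T. \<forall>e\<in>pairs t. w e}" for w
    using pairs_mono[of _ V] by (auto simp: triangles_def)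
  have "measure_pmf.expectation ?M (\<lambda>w. real (card {t \<in> ?T. \<forall>e\<in>pairs t. w e})) =
      (\<Sum>t\<in>?T. measure_pmf.prob ?M {w. \<forall>e\<in>pairs t. w e})"
    using assms by (intro expectation_card) auto
  also have "\<dots> = (\<Sum>t\<in>?T. p ^ 3)"
  proof (intro sum.cong refl)
    fix t assume t: "t \<in> ?T"
    then have "card (pairs t) = 3"
      using assms by (subst card_pairs) (auto intro: finite_subset simp: numeral_eq_Suc)
    then show "measure_pmf.prob ?M {w. \<forall>e\<in>pairs t. w e} = p ^ 3"
      using t assms by (subst prob_all_present) (auto simp: finite_pairs pairs_mono)
  qed
  also have "\<dots> = (card V choose 3) * p ^ 3"
    using assms by (simp add: n_subsets)
  finally show ?thesis
    unfolding T by (subst Bochner_Integration.integral_diff) (auto simp: int edges)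
qed

text \<open>A first moment argument: without a good graph, edges minus \<open>2 * r\<close> times
  triangles would stay below \<open>r ^ 4 / 32\<close> outside the unlikely bad event, contradicting
  its expectation. The weight \<open>2 * r\<close> is the number of edges that deleting one vertex
  can cost.\<close>

lemma exists_good_edge_set:
  "\<exists>N::nat. \<forall>n\<ge>N. \<exists>F \<subseteq> pairs {..<n}.
     (\<forall>v<n. card {u. {u, v} \<in> F} \<le> 2 * real n powr (1/3)) \<and>
     sparse_cross (72 * ln n) {..<n} F \<and>
     real n powr (4/3) / 32 \<le> card F - 2 * real n powr (1/3) * card (triangles {..<n} F)"
proof -
  \<comment> \<open>The factor \<open>n ^ 2\<close> is the crude bound on the number of edges used
    on the bad event.\<close>
  have "\<forall>\<^sub>F n in sequentially. real n ^ 2 * (real n * exp (- 2 * real n powr (1/3)) +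
      (3 * exp (- 3 * ln (real n)) + 9 * exp (- 71 * ln (real n)))) \<le> real n powr (4/3) / 100"
    by real_asymp
  moreover have "\<forall>\<^sub>F n in sequentially. ln (real n) \<ge> 1"
    by real_asymp
  ultimately have "\<forall>\<^sub>F n in sequentially. n \<ge> 2 \<and> ln (real n) \<ge> 1 \<and>
      real n ^ 2 * (real n * exp (- 2 * real n powr (1/3)) +
      (3 * exp (- 3 * ln (real n)) + 9 * exp (- 71 * ln (real n)))) \<le> real n powr (4/3) / 100"
    using eventually_ge_at_top[of 2] by eventually_elim auto
  then obtain N where N: "\<And>n. n \<ge> N \<Longrightarrow> n \<ge> 2 \<and> ln (real n) \<ge> 1 \<and>
      real n ^ 2 * (real n * exp (- 2 * real n powr (1/3)) +
      (3 * exp (- 3 * ln (real n)) + 9 * exp (- 71 * ln (real n)))) \<le> real n powr (4/3) / 100"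
    unfolding eventually_sequentially by blast
  show ?thesis
  proof (intro exI[of _ N] allI impI, rule ccontr)
    fix n assume "n \<ge> N"
    note n = N[OF this]
    let ?V = "{..<n}"
    define r where "r = real n powr (1/3)"
    \<comment> \<open>As \<open>r ^ 3 = n\<close>, this gives \<open>4 * p * n = r\<close>. Expected
      edges and \<open>2 * r\<close> times expected triangles are then both of order
      \<open>r ^ 4\<close>, and the constant 4 lets the edges win.\<close>
    define p where "p = 1 / (4 * r ^ 2)"
    let ?M = "bernoulli_subset (pairs ?V) p"
    let ?F = "\<lambda>w. {e \<in> pairs ?V. w e}"
    let ?X = "\<lambda>w. real (card (?F w)) - 2 * r * real (card (triangles ?V (?F w)))"
    define B where "B = {w. \<not> ((\<forall>v\<in>?V. real (card {u. {u, v} \<in> ?F w}) \<le> 2 * r) \<and>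
                  sparse_cross (72 * ln n) ?V (?F w))}"
    assume contr: "\<not> (\<exists>F \<subseteq> pairs {..<n}.
     (\<forall>v<n. card {u. {u, v} \<in> F} \<le> 2 * real n powr (1/3)) \<and>
     sparse_cross (72 * ln n) {..<n} F \<and>
     real n powr (4/3) / 32 \<le> card F - 2 * real n powr (1/3) * card (triangles {..<n} F))"
    have r1: "r \<ge> 1"
      unfolding r_def using n by (intro ge_one_powr_ge_zero) auto
    have r3: "r ^ 3 = n" and r4: "r ^ 4 = real n powr (4/3)"
      using n by (simp_all add: r_def powr_power)
    have "1 \<le> r ^ 2" using r1 by (rule one_le_power)
    then have p: "0 < p" "p \<le> 1"
      using r1 unfolding p_def by (auto simp: field_simps simp del: one_le_power)
    have "4 * p * real n = r"
      using r1 by (simp add: p_def flip: r3) (simp add: power3_eq_cube power2_eq_square)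
    then have "measure_pmf.prob ?M B \<le> real n * exp (- 2 * r) +
        (3 * exp (- 3 * ln (real n)) + 9 * exp (- 71 * ln (real n)))"
      using prob_bad_le[of ?V p r] p n unfolding B_def by simp
    then have "real n ^ 2 * measure_pmf.prob ?M B \<le> real n ^ 2 * (real n * exp (- 2 * r) +
        (3 * exp (- 3 * ln (real n)) + 9 * exp (- 71 * ln (real n))))"
      by (intro mult_left_mono) auto
    also have "\<dots> \<le> r ^ 4 / 100"
      using n by (simp add: r_def r4[unfolded r_def])
    finally have PB: "real n ^ 2 * measure_pmf.prob ?M B \<le> r ^ 4 / 100" .
    have X_le: "?X w \<le> r ^ 4 / 32 + real n ^ 2 * indicator B w" for w
    proof (cases "w \<in> B")
      case False
      then show ?thesis
        using contr[simplified, rule_format, of "?F w"] unfolding r4 by (auto simp: B_def r_def)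
    next
      case True
      have "card (?F w) \<le> card (pairs ?V)"
        by (intro card_mono) (auto simp: finite_pairs)
      also have "\<dots> \<le> n ^ 2"
        using binomial_le_pow[of 2 n] n by (simp add: card_pairs)
      finally have "real (card (?F w)) \<le> real n ^ 2"
        by (metis of_nat_le_iff of_nat_power)
      moreover have "0 \<le> 2 * r * real (card (triangles ?V (?F w)))" "0 \<le> r ^ 4"
        using r1 by auto
      ultimately have "?X w \<le> r ^ 4 / 32 + real n ^ 2" by linarith
      then show ?thesis using True by simp
    qed
    have int: "integrable ?M f" for f :: "_ \<Rightarrow> real"
      by (intro integrable_measure_pmf_finite finite_set_bernoulli_subset finite_pairs) auto
    have "measure_pmf.expectation ?M ?X \<le>
        measure_pmf.expectation ?M (\<lambda>w. r ^ 4 / 32 + real n ^ 2 * indicator B w)"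
      using X_le by (intro integral_mono int)
    also have "\<dots> = r ^ 4 / 32 + real n ^ 2 * measure_pmf.prob ?M B"
      by (subst Bochner_Integration.integral_add) (auto simp: int)
    also have "\<dots> \<le> r ^ 4 / 32 + r ^ 4 / 100"
      using PB by simp
    finally have upper: "measure_pmf.expectation ?M ?X \<le> r ^ 4 / 32 + r ^ 4 / 100" .
    have c2: "real (n choose 2) = real n * (real n - 1) / 2"
      by (cases n) (auto simp: choose_two real_of_nat_div algebra_simps)
    have "real (n choose 2) * p \<ge> real n * (real n / 2) / 2 * p"
      unfolding c2 using n p by (intro mult_right_mono divide_right_mono mult_left_mono) auto
    also have "real n * (real n / 2) / 2 * p = r ^ 4 / 16"
      using r1 by (simp add: p_def field_simps flip: r3 power_add)
    finally have e: "real (n choose 2) * p \<ge> r ^ 4 / 16" .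
    have c3: "real (n choose 3) \<le> real n ^ 3 / 6"
      using binomial_fact_pow[of n 3] by (simp add: fact_numeral flip: of_nat_power of_nat_mult)
    have "2 * r * (real (n choose 3) * p ^ 3) \<le> 2 * r * (real n ^ 3 / 6 * p ^ 3)"
      using c3 p r1 by (intro mult_left_mono mult_right_mono) auto
    also have "\<dots> = r ^ 4 / 192"
      using r1 by (simp add: p_def field_simps flip: r3 power_add power_mult)
         (simp add: eval_nat_numeral)
    finally have t: "2 * r * (real (n choose 3) * p ^ 3) \<le> r ^ 4 / 192" .
    have "measure_pmf.expectation ?M ?X = real (n choose 2) * p - 2 * r * (real (n choose 3) * p ^ 3)"
      using expectation_edges_minus_triangles[of ?V p "2 * r"] p by simp
    moreover have "r ^ 4 > 0" using r1 by simp
    \<comment> \<open>The contradiction is \<open>1/16 - 1/192 > 1/32 + 1/100\<close>.\<close>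
    ultimately show False
      using upper e t by linarith
  qed
qed

subsection \<open>Dense triangle-free induced subgraphs\<close>

lemma finite_triangles: "finite V \<Longrightarrow> finite (triangles V F)"
  by (rule finite_subset[of _ "Pow V"]) (auto simp: triangles_def)

text \<open>One vertex \<open>f t\<close> is deleted from each triangle \<open>t\<close>. Every lost
  edge contains a deleted vertex, and each deleted vertex lies on at most \<open>D\<close>
  edges.\<close>

lemma exists_triangle_free_subset:
  fixes D :: real
  assumes V: "finite V" and F: "F \<subseteq> pairs V"
    and deg: "\<And>v. v \<in> V \<Longrightarrow> card {u. {u, v} \<in> F} \<le> D"
  shows "\<exists>U \<subseteq> V. triangles U F = {} \<and>
           card F - D * card (triangles V F) \<le> card (F \<inter> pairs U)"
proof -
  let ?T = "triangles V F"
  have "\<exists>x. x \<in> t" if "t \<in> ?T" for t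
    using that by (auto simp: triangles_def card_3_iff)
  then obtain f where f: "\<And>t. t \<in> ?T \<Longrightarrow> f t \<in> t"
    by metis
  define U where "U = V - f ` ?T"
  have fin: "finite ?T" "finite F"
    using V F finite_triangles finite_pairs finite_subset by blast+
  have "triangles U F = {}"
  proof (rule equals0I)
    fix t assume "t \<in> triangles U F"
    then have "t \<in> ?T" "t \<subseteq> U" by (auto simp: triangles_def U_def)
    then show False using f[of t] by (auto simp: U_def)
  qed
  have "F - pairs U \<subseteq> (\<Union>t\<in>?T. {e \<in> F. f t \<in> e})"
  proof
    fix e assume e: "e \<in> F - pairs U"
    then have "e \<subseteq> V" "card e = 2" using F by (auto simp: pairs_def)
    then have "\<exists>v\<in>e. v \<notin> U" using e by (auto simp: pairs_def)
    then show "e \<in> (\<Union>t\<in>?T. {e \<in> F. f t \<in> e})"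
      using \<open>e \<subseteq> V\<close> e by (auto simp: U_def)
  qed
  then have "card (F - pairs U) \<le> card (\<Union>t\<in>?T. {e \<in> F. f t \<in> e})"
    using fin by (intro card_mono) auto
  also have "\<dots> \<le> (\<Sum>t\<in>?T. card {e \<in> F. f t \<in> e})"
    using fin by (intro card_UN_le)
  finally have "real (card (F - pairs U)) \<le> (\<Sum>t\<in>?T. real (card {e \<in> F. f t \<in> e}))"
    by (metis of_nat_le_iff of_nat_sum)
  also have "\<dots> \<le> (\<Sum>t\<in>?T. D)"
  proof (intro sum_mono)
    fix t assume "t \<in> ?T"
    then have "f t \<in> V" using f by (auto simp: triangles_def)
    then show "real (card {e \<in> F. f t \<in> e}) \<le> D"
      using deg card_neighbours_eq[OF F] by simp
  qed
  finally have "real (card (F - pairs U)) \<le> D * card ?T" by (simp add: mult.commute)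
  moreover have "card F = card (F \<inter> pairs U) + card (F - pairs U)"
    using fin card_Int_Diff[of F "pairs U"] by (simp add: Int_commute)
  ultimately show ?thesis
    using \<open>triangles U F = {}\<close> by (intro exI[of _ U]) (auto simp: U_def)
qed

lemma card_induced_edges_remove:
  assumes "finite W" "v \<in> W" and F: "F \<subseteq> pairs V"
  shows "card (F \<inter> pairs W) = card (F \<inter> pairs (W - {v})) + card {u \<in> W. {u, v} \<in> F}"
proof -
  have fin: "finite (F \<inter> pairs W)"
    using assms by (simp add: finite_pairs)
  have "F \<inter> pairs W = (F \<inter> pairs (W - {v})) \<union> {e \<in> F \<inter> pairs W. v \<in> e}"
    by (auto simp: pairs_def)
  moreover have "(F \<inter> pairs (W - {v})) \<inter> {e \<in> F \<inter> pairs W. v \<in> e} = {}"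
    by (auto simp: pairs_def)
  moreover have "finite (F \<inter> pairs (W - {v}))"
    using fin pairs_mono[of "W - {v}" W] by (rule_tac finite_subset) auto
  moreover have "finite {e \<in> F \<inter> pairs W. v \<in> e}"
    using fin by (rule rev_finite_subset) auto
  ultimately have "card (F \<inter> pairs W) =
      card (F \<inter> pairs (W - {v})) + card {e \<in> F \<inter> pairs W. v \<in> e}"
    by (metis (no_types, lifting) card_Un_disjoint)
  also have "card {e \<in> F \<inter> pairs W. v \<in> e} = card {u. {u, v} \<in> F \<inter> pairs W}"
    by (rule card_neighbours_eq[symmetric, where V = W]) auto
  also have "{u. {u, v} \<in> F \<inter> pairs W} = {u \<in> W. {u, v} \<in> F}"
    using edge_endpoints[OF F] assms(2) by (auto simp: doubleton_in_pairs_iff)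
  finally show ?thesis .
qed

text \<open>A subset maximising the number of induced edges minus \<open>d\<close> times its size has minimum
  degree at least \<open>d\<close>, as deleting a vertex of smaller degree would increase that quantity.\<close>

lemma exists_min_degree_subset:
  fixes d :: real
  assumes U: "finite U" and F: "F \<subseteq> pairs V"
  shows "\<exists>W \<subseteq> U. (\<forall>v\<in>W. d \<le> card {u \<in> W. {u, v} \<in> F}) \<and>
           card (F \<inter> pairs U) - d * card U \<le> card (F \<inter> pairs W) - d * card W"
proof -
  define g where "g W = real (card (F \<inter> pairs W)) - d * card W" for W
  have fin: "finite (g ` Pow U)" "g ` Pow U \<noteq> {}" using U by auto
  obtain W where W: "W \<subseteq> U" "g W = Max (g ` Pow U)"
    using Max_in[OF fin] by (metis PowD imageE)
  have max: "g W' \<le> g W" if "W' \<subseteq> U" for W'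
    unfolding W(2) using fin that by (intro Max_ge) auto
  have "d \<le> card {u \<in> W. {u, v} \<in> F}" if v: "v \<in> W" for v
  proof -
    have finW: "finite W" using W U finite_subset by blast
    have "g (W - {v}) \<le> g W" using W by (intro max) auto
    moreover have "real (card W) = card (W - {v}) + 1"
      using card.remove[OF finW v] by simp
    ultimately show ?thesis
      using card_induced_edges_remove[OF finW v F] by (simp add: g_def algebra_simps)
  qed
  then show ?thesis
    using W max[of U] by (intro exI[of _ W]) (auto simp: g_def)
qed

text \<open>Each induced edge contains a vertex of \<open>W\<close>. Read backwards, many edges and
  small degrees force \<open>W\<close> to be large.\<close>

lemma card_induced_edges_le:
  fixes D :: real
  assumes W: "finite W" and F: "F \<subseteq> pairs V"
    and deg: "\<And>v. v \<in> W \<Longrightarrow> card {u. {u, v} \<in> F} \<le> D" and "finite V"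
  shows "card (F \<inter> pairs W) \<le> D * card W"
proof -
  have finF: "finite F" using assms finite_pairs finite_subset by blast
  have "F \<inter> pairs W \<subseteq> (\<Union>v\<in>W. {e \<in> F. v \<in> e})"
    by (auto simp: pairs_def card_2_iff)
  then have "card (F \<inter> pairs W) \<le> card (\<Union>v\<in>W. {e \<in> F. v \<in> e})"
    using W finF by (intro card_mono) auto
  also have "\<dots> \<le> (\<Sum>v\<in>W. card {e \<in> F. v \<in> e})"
    using W by (rule card_UN_le)
  finally have "real (card (F \<inter> pairs W)) \<le> (\<Sum>v\<in>W. real (card {e \<in> F. v \<in> e}))"
    by (metis of_nat_le_iff of_nat_sum)
  also have "\<dots> \<le> (\<Sum>v\<in>W. D)"
    using deg card_neighbours_eq[OF F] by (intro sum_mono) simp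
  finally show ?thesis by (simp add: mult.commute)
qed

subsection \<open>Pulling back a graph along a map\<close>

text \<open>For surjective \<open>f\<close> this is a blow-up: each vertex is replaced by its fibre.
  Vertices of one fibre are nonadjacent twins when \<open>F\<close> consists of two-element
  sets.\<close>

definition pullback_graph :: "'b set \<Rightarrow> ('b \<Rightarrow> 'a) \<Rightarrow> 'a set set \<Rightarrow> 'b pair_pre_digraph" where
  "pullback_graph X f F = \<lparr>pverts = X, parcs = {(u, v). u \<in> X \<and> v \<in> X \<and> {f u, f v} \<in> F}\<rparr>"

lemma dominates_pullback_graph_iff:
  "u \<rightarrow>\<^bsub>with_proj (pullback_graph X f F)\<^esub> v \<longleftrightarrow> u \<in> X \<and> v \<in> X \<and> {f u, f v} \<in> F"
  by (auto simp: pullback_graph_def arcs_ends_def arc_to_ends_def)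

lemma pair_graph_pullback_graph:
  assumes "finite X" "F \<subseteq> pairs W"
  shows "pair_graph (pullback_graph X f F)"
proof
  show "finite (parcs (pullback_graph X f F))"
    using assms by (auto simp: pullback_graph_def intro: finite_subset[of _ "X \<times> X"])
  show "symmetric (with_proj (pullback_graph X f F))"
    by (auto simp: symmetric_def sym_def pullback_graph_def insert_commute)
  show "fst e \<noteq> snd e" if "e \<in> parcs (pullback_graph X f F)" for e
    using that edge_endpoints[OF assms(2), of "f (fst e)" "f (snd e)"]
    by (auto simp: pullback_graph_def)
qed (use assms in \<open>auto simp: pullback_graph_def\<close>)

lemma out_degree_with_proj:
  "out_degree (with_proj G) u = card {v. (u, v) \<in> parcs G}"
  unfolding out_degree_def out_arcs_def
  by (rule bij_betw_same_card[of snd]) (auto simp: bij_betw_def inj_on_def image_iff)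

text \<open>Adjacent vertices have distinct images because \<open>F\<close> has no loops, so a
  triangle would map onto a triangle of \<open>F\<close>.\<close>

lemma triangle_free_pullback_graph:
  assumes F: "F \<subseteq> pairs W" and "triangles W F = {}"
  shows "triangle_free (with_proj (pullback_graph X f F))"
proof -
  have False if *: "{a, b} \<in> F" "{b, c} \<in> F" "{c, a} \<in> F" for a b c
  proof -
    have d: "a \<in> W" "b \<in> W" "c \<in> W" "a \<noteq> b" "b \<noteq> c" "c \<noteq> a"
      using * edge_endpoints[OF F] by blast+
    have "pairs {a, b, c} \<subseteq> {{a, b}, {b, c}, {c, a}}"
    proof (intro subsetI)
      fix e assume "e \<in> pairs {a, b, c}"
      then obtain x y where "e = {x, y}" "x \<noteq> y" "x \<in> {a, b, c}" "y \<in> {a, b, c}"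
        by (auto simp: pairs_def card_2_iff)
      then show "e \<in> {{a, b}, {b, c}, {c, a}}"
        by (elim insertE emptyE) (simp_all add: insert_commute)
    qed
    then have "{a, b, c} \<in> triangles W F"
      using d * unfolding triangles_def by auto
    then show False using assms by simp
  qed
  then show ?thesis
    unfolding triangle_free_def dominates_pullback_graph_iff by blast
qed

lemma card_vimage_le:
  assumes "finite N" "\<And>a. a \<in> N \<Longrightarrow> card {x \<in> X. f x = a} \<le> k"
  shows "card {x \<in> X. f x \<in> N} \<le> k * card N"
proof -
  have "{x \<in> X. f x \<in> N} = (\<Union>a\<in>N. {x \<in> X. f x = a})"
    by auto
  then have "card {x \<in> X. f x \<in> N} \<le> (\<Sum>a\<in>N. card {x \<in> X. f x = a})"
    using assms card_UN_le by metis
  also have "\<dots> \<le> (\<Sum>a\<in>N. k)"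
    using assms by (intro sum_mono)
  finally show ?thesis by (simp add: mult.commute)
qed

text \<open>The neighbourhood of \<open>x\<close> is the union of the fibres over the neighbours of
  \<open>f x\<close>, and each fibre has between 1 and \<open>k\<close> elements.\<close>

lemma out_degree_pullback_graph_bounds:
  assumes "finite X" "finite W" "F \<subseteq> pairs W" "f ` X = W"
    and k: "\<And>a. a \<in> W \<Longrightarrow> card {x \<in> X. f x = a} \<le> k" and "x \<in> X"
  shows "card {u. {u, f x} \<in> F} \<le> out_degree (with_proj (pullback_graph X f F)) x"
    and "out_degree (with_proj (pullback_graph X f F)) x \<le> k * card {u. {u, f x} \<in> F}"
proof -
  let ?N = "{u. {u, f x} \<in> F}"
  have N: "?N \<subseteq> W"
    using edge_endpoints[OF assms(3)] by blast
  have deg: "out_degree (with_proj (pullback_graph X f F)) x = card {y \<in> X. f y \<in> ?N}"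
    unfolding out_degree_with_proj using \<open>x \<in> X\<close>
    by (intro arg_cong[of _ _ card]) (auto simp: pullback_graph_def insert_commute)
  show "card ?N \<le> out_degree (with_proj (pullback_graph X f F)) x"
    unfolding deg
  proof (rule surj_card_le[of _ _ f])
    show "?N \<subseteq> f ` {y \<in> X. f y \<in> ?N}"
      using N \<open>f ` X = W\<close> by blast
  qed (use \<open>finite X\<close> in simp)
  show "out_degree (with_proj (pullback_graph X f F)) x \<le> k * card ?N"
    unfolding deg using N assms by (intro card_vimage_le) (auto intro: finite_subset)
qed

section \<open>Average degrees of semi-bipartite subgraphs of the pullback\<close>

lemma sum_out_degree_bipartite_between_le:
  assumes fin: "finite V1" "finite V2" and sym: "\<And>u v. u \<rightarrow>\<^bsub>G\<^esub> v \<Longrightarrow> v \<rightarrow>\<^bsub>G\<^esub> u"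
  shows "(\<Sum>v\<in>V1 \<union> V2. out_degree (with_proj (bipartite_between G V1 V2)) v)
         \<le> 2 * card {(u, v) \<in> V1 \<times> V2. u \<rightarrow>\<^bsub>G\<^esub> v}"
proof -
  let ?B = "parcs (bipartite_between G V1 V2)"
  let ?E = "{(u, v) \<in> V1 \<times> V2. u \<rightarrow>\<^bsub>G\<^esub> v}"
  have finE: "finite ?E"
    using fin by (auto intro: finite_subset[of _ "V1 \<times> V2"])
  have sub: "?B \<subseteq> ?E \<union> prod.swap ` ?E"
    using sym by (auto simp: bipartite_between_def image_iff)
  then have finB: "finite ?B"
    using finE by (auto intro: finite_subset)
  have "(\<Sum>v\<in>V1 \<union> V2. out_degree (with_proj (bipartite_between G V1 V2)) v) =
      card (\<Union>v\<in>V1 \<union> V2. {e \<in> ?B. fst e = v})"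
    unfolding out_degree_def out_arcs_def using fin finB
    by (subst card_UN_disjoint) auto
  also have "\<dots> \<le> card (?E \<union> prod.swap ` ?E)"
    using finE sub by (intro card_mono) auto
  also have "\<dots> \<le> card ?E + card ?E"
    using card_Un_le[of ?E "prod.swap ` ?E"] card_image_le[OF finE, of prod.swap] by linarith
  finally show ?thesis by simp
qed

lemma card_cross_arcs_pullback_graph_le:
  fixes c :: real and k :: nat
  assumes "finite X" "finite W" and F: "F \<subseteq> pairs W" and "f ` X \<subseteq> W"
    and k: "\<And>a. a \<in> W \<Longrightarrow> card {x \<in> X. f x = a} \<le> k"
    and sparse: "sparse_cross c W F" and "0 \<le> c"
    and V: "V1 \<subseteq> X" "V2 \<subseteq> X" and stable: "stable_set (with_proj (pullback_graph X f F)) V1"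
  shows "card {(u, v) \<in> V1 \<times> V2. u \<rightarrow>\<^bsub>with_proj (pullback_graph X f F)\<^esub> v}
         \<le> (real k)\<^sup>2 * c * (card V1 + card V2)"
proof -
  \<comment> \<open>Twins can put a vertex into both images, but \<open>sparse_cross\<close> needs
    disjoint sets. Removing \<open>f\<close>
    V1\<open>from the second image loses no arcs from\<close>V1\<open>to\<close>V2\<open>, since\<close>f
    \<open>V1\<close> is stable.\<close>
  let ?A = "f ` V1" and ?B = "f ` V2 - f ` V1"
  have fin: "finite V1" "finite V2" using assms finite_subset by blast+
  have st: "{a, b} \<notin> F" if ab: "a \<in> ?A" "b \<in> ?A" for a b
  proof -
    obtain x y where xy: "x \<in> V1" "y \<in> V1" "a = f x" "b = f y"
      using ab by blast
    then have "\<not> x \<rightarrow>\<^bsub>with_proj (pullback_graph X f F)\<^esub> y"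
      using stable by (simp add: stable_set_def)
    moreover have "x \<in> X" "y \<in> X" using xy V by auto
    ultimately show ?thesis
      unfolding dominates_pullback_graph_iff by (simp add: xy)
  qed
  have "stable_in F ?A"
    unfolding stable_in_def
  proof (rule equals0I)
    fix e assume e: "e \<in> pairs ?A \<inter> F"
    then obtain a b where "e = {a, b}" "a \<in> ?A" "b \<in> ?A"
      by (auto simp: pairs_def card_2_iff)
    then show False using st e by blast
  qed
  moreover have AB: "?A \<subseteq> W" "?B \<subseteq> W" "?A \<inter> ?B = {}"
    using V \<open>f ` X \<subseteq> W\<close> by blast+
  ultimately have s: "card (cross_edges F ?A ?B) \<le> c * (card ?A + card ?B)"
    using sparse unfolding sparse_cross_def by blast
  have finC: "finite (cross_edges F ?A ?B)"
    using fin by (auto simp: cross_edges_def intro: finite_subset[of _ "?A \<times> ?B"])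
  have "{(u, v) \<in> V1 \<times> V2. u \<rightarrow>\<^bsub>with_proj (pullback_graph X f F)\<^esub> v}
      \<subseteq> {z \<in> X \<times> X. map_prod f f z \<in> cross_edges F ?A ?B}"
  proof (rule subsetI, clarify)
    fix u v assume uv: "u \<in> V1" "v \<in> V2" and "u \<rightarrow>\<^bsub>with_proj (pullback_graph X f F)\<^esub> v"
    then have e: "u \<in> X" "v \<in> X" "{f u, f v} \<in> F"
      unfolding dominates_pullback_graph_iff by auto
    moreover have "f v \<notin> f ` V1"
      using st[of "f u" "f v"] e(3) uv(1) by blast
    ultimately show "(u, v) \<in> X \<times> X \<and> map_prod f f (u, v) \<in> cross_edges F ?A ?B"
      using uv by (simp add: cross_edges_def)
  qed
  then have "card {(u, v) \<in> V1 \<times> V2. u \<rightarrow>\<^bsub>with_proj (pullback_graph X f F)\<^esub> v}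
      \<le> card {z \<in> X \<times> X. map_prod f f z \<in> cross_edges F ?A ?B}"
    using assms by (intro card_mono) auto
  \<comment> \<open>Each cross edge has at most \<open>k\<close> choices of preimage for either
    endpoint.\<close>
  also have "\<dots> \<le> (k * k) * card (cross_edges F ?A ?B)"
  proof (intro card_vimage_le finC)
    fix z assume "z \<in> cross_edges F ?A ?B"
    then obtain a b where z: "z = (a, b)" "a \<in> ?A" "b \<in> ?B"
      by (auto simp: cross_edges_def)
    then have "a \<in> W" "b \<in> W"
      using subsetD[OF AB(1)] subsetD[OF AB(2)] by simp_all
    have "{y \<in> X \<times> X. map_prod f f y = z} = {x \<in> X. f x = a} \<times> {x \<in> X. f x = b}"
      by (auto simp: z(1))
    then show "card {y \<in> X \<times> X. map_prod f f y = z} \<le> k * k"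
      using k[OF \<open>a \<in> W\<close>] k[OF \<open>b \<in> W\<close>] by (simp add: card_cartesian_product mult_le_mono)
  qed
  finally have "real (card {(u, v) \<in> V1 \<times> V2. u \<rightarrow>\<^bsub>with_proj (pullback_graph X f F)\<^esub> v})
      \<le> real ((k * k) * card (cross_edges F ?A ?B))"
    by (rule of_nat_mono)
  also have "\<dots> = (real k)\<^sup>2 * real (card (cross_edges F ?A ?B))"
    by (simp add: power2_eq_square)
  also have "\<dots> \<le> (real k)\<^sup>2 * (c * (card ?A + card ?B))"
    using s by (intro mult_left_mono) auto
  also have "\<dots> \<le> (real k)\<^sup>2 * (c * (card V1 + card V2))"
  proof (intro mult_left_mono of_nat_mono add_mono)
    show "card ?A \<le> card V1" using fin by (rule_tac card_image_le)
    have "card ?B \<le> card (f ` V2)" using fin by (intro card_mono) auto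
    also have "\<dots> \<le> card V2" using fin by (rule_tac card_image_le)
    finally show "card ?B \<le> card V2" .
  qed (use \<open>0 \<le> c\<close> in auto)
  finally show ?thesis by (simp add: mult.assoc)
qed

lemma not_has_semi_bipartite_pullback_graph:
  fixes c x :: real and k :: nat
  assumes "finite X" "finite W" and F: "F \<subseteq> pairs W" and "f ` X \<subseteq> W"
    and "\<And>a. a \<in> W \<Longrightarrow> card {x \<in> X. f x = a} \<le> k"
    and "sparse_cross c W F" and "0 \<le> c" and x: "2 * (real k)\<^sup>2 * c < x"
  shows "\<not> has_semi_bipartite_induced_subgraph (with_proj (pullback_graph X f F)) x"
proof
  let ?G = "with_proj (pullback_graph X f F)"
  assume "has_semi_bipartite_induced_subgraph ?G x"
  then obtain H V1 V2 where H: "induced_subgraph H ?G" "semi_bipartition ?G H V1 V2"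
    and avg: "average_degree (with_proj (bipartite_between ?G V1 V2)) \<ge> x"
    unfolding has_semi_bipartite_induced_subgraph_def by blast
  have "verts H \<subseteq> X"
    using H(1) by (auto simp: induced_subgraph_def subgraph_def pullback_graph_def)
  then have V: "V1 \<subseteq> X" "V2 \<subseteq> X" "V1 \<inter> V2 = {}" "stable_set ?G V1"
    using H(2) by (auto simp: semi_bipartition_def)
  have fin: "finite V1" "finite V2" using V assms finite_subset by blast+
  define s where "s = (\<Sum>v\<in>V1 \<union> V2. out_degree (with_proj (bipartite_between ?G V1 V2)) v)"
  define m where "m = card {(u, v) \<in> V1 \<times> V2. u \<rightarrow>\<^bsub>?G\<^esub> v}"
  have "v \<rightarrow>\<^bsub>?G\<^esub> u" if "u \<rightarrow>\<^bsub>?G\<^esub> v" for u v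
    using that unfolding dominates_pullback_graph_iff by (simp add: insert_commute)
  then have "s \<le> 2 * m"
    unfolding s_def m_def by (rule sum_out_degree_bipartite_between_le[OF fin])
  then have "real s \<le> 2 * real m" by linarith
  also have "real m \<le> (real k)\<^sup>2 * c * (card V1 + card V2)"
    unfolding m_def by (rule card_cross_arcs_pullback_graph_le[OF assms(1-7) V(1,2,4)])
  also have "card V1 + card V2 = card (V1 \<union> V2)"
    using fin V by (simp add: card_Un_disjoint)
  finally have "real s \<le> 2 * (real k)\<^sup>2 * c * card (V1 \<union> V2)" by simp
  \<comment> \<open>For the empty subgraph the quotient is \<open>0 / 0 = 0\<close>, and the bound
    reduces to \<open>0 \<le> c\<close>.\<close>
  then have "real s / card (V1 \<union> V2) \<le> 2 * (real k)\<^sup>2 * c"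
    using \<open>0 \<le> c\<close> by (cases "card (V1 \<union> V2) = 0") (simp_all add: pos_divide_le_eq)
  moreover have "average_degree (with_proj (bipartite_between ?G V1 V2)) = real s / card (V1 \<union> V2)"
    by (simp add: average_degree_def s_def bipartite_between_def)
  ultimately show False
    using avg x by linarith
qed

section \<open>Restriction to a subset, balanced fibres and the final assembly\<close>

lemma sparse_cross_induced:
  assumes "sparse_cross c V F" "W \<subseteq> V"
  shows "sparse_cross c W (F \<inter> pairs W)"
  unfolding sparse_cross_def
proof (intro allI impI)
  fix A B assume AB: "A \<subseteq> W" "B \<subseteq> W" "A \<inter> B = {}" "stable_in (F \<inter> pairs W) A"
  have "stable_in F A"
    using AB pairs_mono[of A W] by (auto simp: stable_in_def)
  moreover have "cross_edges (F \<inter> pairs W) A B = cross_edges F A B"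
    using AB by (auto simp: cross_edges_def doubleton_in_pairs_iff)
  ultimately show "card (cross_edges (F \<inter> pairs W) A B) \<le> c * (card A + card B)"
    using assms AB unfolding sparse_cross_def by auto
qed

text \<open>The numbers below \<open>n\<close> run cyclically through \<open>W\<close>. Within a
  fibre \<open>x\<close> is determined by \<open>x div card W\<close>, which takes at most
  \<open>n div card W + 1\<close> values.\<close>

lemma exists_balanced_surjection:
  assumes W: "finite W" "W \<noteq> {}" "card W \<le> n"
  shows "\<exists>f. f ` {..<n} = W \<and> (\<forall>a\<in>W. card {x \<in> {..<n}. f x = a} \<le> n div card W + 1)"
proof -
  let ?s = "card W"
  have s: "?s > 0" using W by (simp add: card_gt_0_iff)
  obtain h where h: "bij_betw h {..<?s} W"
    using ex_bij_betw_nat_finite[OF W(1)] by (auto simp: atLeast0LessThan)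
  define f where "f x = h (x mod ?s)" for x
  have "f ` {..<n} = W"
  proof
    show "f ` {..<n} \<subseteq> W"
      using h s by (auto simp: f_def bij_betw_def)
    have "h ` {..<?s} \<subseteq> f ` {..<n}"
    proof
      fix a assume "a \<in> h ` {..<?s}"
      then obtain x where "x < ?s" "a = h x" by auto
      then have "a = f x" "x < n" using W(3) by (simp_all add: f_def)
      then show "a \<in> f ` {..<n}" by blast
    qed
    then show "W \<subseteq> f ` {..<n}"
      using h by (simp add: bij_betw_def)
  qed
  moreover have "card {x \<in> {..<n}. f x = a} \<le> n div ?s + 1" for a
  proof -
    have "inj_on (\<lambda>x. x div ?s) {x \<in> {..<n}. f x = a}"
    proof (rule inj_onI)
      fix x y assume "x \<in> {x \<in> {..<n}. f x = a}" "y \<in> {x \<in> {..<n}. f x = a}"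
        and div: "x div ?s = y div ?s"
      then have "h (x mod ?s) = h (y mod ?s)" by (simp add: f_def)
      then have "x mod ?s = y mod ?s"
        using h s by (auto simp: bij_betw_def inj_on_def)
      then show "x = y" using div by (metis div_mult_mod_eq)
    qed
    moreover have "(\<lambda>x. x div ?s) ` {x \<in> {..<n}. f x = a} \<subseteq> {..n div ?s}"
      by (auto intro: div_le_mono)
    ultimately have "card {x \<in> {..<n}. f x = a} \<le> card {..n div ?s}"
      by (intro card_inj_on_le) auto
    then show ?thesis by simp
  qed
  ultimately show ?thesis by blast
qed

theorem theorem3p9:
  shows "\<exists>C C' C'' :: real. C > 0 \<and> C' > 0 \<and> C'' > 0 \<and>
    (\<exists>N :: nat. \<forall>n \<ge> N. \<exists>G :: nat pair_pre_digraph.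
       pair_graph G \<and> card (pverts G) = n \<and>
       triangle_free (with_proj G) \<and>
       (\<forall>v \<in> pverts G.
          C' * real n powr (1/3) \<le> real (out_degree (with_proj G) v) \<and>
          real (out_degree (with_proj G) v) \<le> C'' * real n powr (1/3)) \<and>
       \<not> has_semi_bipartite_induced_subgraph (with_proj G) (C * ln (real n)))"
proof -
  obtain N where N: "\<And>n. n \<ge> N \<Longrightarrow> \<exists>F \<subseteq> pairs {..<n}.
     (\<forall>v<n. card {u. {u, v} \<in> F} \<le> 2 * real n powr (1/3)) \<and>
     sparse_cross (72 * ln n) {..<n} F \<and>
     real n powr (4/3) / 32 \<le> card F - 2 * real n powr (1/3) * card (triangles {..<n} F)"
    using exists_good_edge_set by blast
  \<comment> \<open>This is \<open>2 * k ^ 2 * 72\<close> for fibres of size at most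
    \<open>k = 129\<close>, plus 1 to make the required inequality strict.\<close>
  define C :: real where "C = 2 * 129\<^sup>2 * 72 + 1"
  have "\<exists>G :: nat pair_pre_digraph. pair_graph G \<and> card (pverts G) = n \<and>
       triangle_free (with_proj G) \<and>
       (\<forall>v \<in> pverts G.
          (1/64) * real n powr (1/3) \<le> real (out_degree (with_proj G) v) \<and>
          real (out_degree (with_proj G) v) \<le> 258 * real n powr (1/3)) \<and>
       \<not> has_semi_bipartite_induced_subgraph (with_proj G) (C * ln (real n))"
    if n: "n \<ge> max N 2" for n
  proof -
    let ?V = "{..<n}"
    define r where "r = real n powr (1/3)"
    have r: "r > 0" "r ^ 3 = n" "r ^ 4 = real n powr (4/3)"
      using n by (simp_all add: r_def powr_power)
    obtain F where F: "F \<subseteq> pairs ?V" "\<And>v. v \<in> ?V \<Longrightarrow> card {u. {u, v} \<in> F} \<le> 2 * r"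
        "sparse_cross (72 * ln n) ?V F" "r ^ 4 / 32 \<le> card F - 2 * r * card (triangles ?V F)"
      using N[of n] n unfolding r_def[symmetric] r(3)[symmetric] by auto
    have "\<exists>U \<subseteq> ?V. triangles U F = {} \<and>
        card F - 2 * r * card (triangles ?V F) \<le> card (F \<inter> pairs U)"
      by (intro exists_triangle_free_subset F(1,2)) auto
    then obtain U where U: "U \<subseteq> ?V" "triangles U F = {}" "r ^ 4 / 32 \<le> card (F \<inter> pairs U)"
      using order_trans[OF F(4)] by blast
    have finU: "finite U" using U finite_subset by blast
    \<comment> \<open>With \<open>card U \<le> r ^ 3\<close>, the threshold \<open>r / 64\<close>
      costs at most \<open>r ^ 4 / 64\<close>, half of the edges guaranteed in
      \<open>U\<close>.\<close>
    obtain W where W: "W \<subseteq> U" "\<And>v. v \<in> W \<Longrightarrow> r / 64 \<le> card {u \<in> W. {u, v} \<in> F}"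
      and W_edges: "card (F \<inter> pairs U) - r / 64 * card U \<le> card (F \<inter> pairs W) - r / 64 * card W"
      using exists_min_degree_subset[OF finU F(1), of "r / 64"] by blast
    have WV: "W \<subseteq> ?V" and finW: "finite W" using W(1) U finU finite_subset by blast+
    have "card U \<le> n" "card W \<le> n"
      using card_mono[OF _ U(1)] card_mono[OF _ WV] by auto
    have "r / 64 * card U \<le> r / 64 * r ^ 3"
      unfolding r using \<open>card U \<le> n\<close> r by (intro mult_left_mono) auto
    also have "\<dots> = r ^ 4 / 64" by (simp add: eval_nat_numeral)
    finally have "r ^ 4 / 64 \<le> card (F \<inter> pairs W) - r / 64 * card W"
      using U(3) W_edges by linarith
    also have "\<dots> \<le> card (F \<inter> pairs W)"
      using r by simp
    \<comment> \<open>Comparing with \<open>r ^ 4 / 64\<close> gives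
      \<open>card W \<ge> r ^ 3 / 128 = n / 128\<close>, so bounded fibres suffice to reach
      \<open>n\<close> vertices.\<close>
    also have "\<dots> \<le> 2 * r * card W"
      using F(2) WV by (intro card_induced_edges_le[OF finW F(1)]) auto
    finally have "r * r ^ 3 \<le> r * (128 * card W)"
      by (simp add: eval_nat_numeral)
    then have "real n \<le> 128 * card W"
      using r by simp
    then have nW: "n \<le> 128 * card W" by linarith
    then have "W \<noteq> {}" using n by auto
    have fibre: "n div card W + 1 \<le> 129"
      using div_le_mono[OF nW, of "card W"] \<open>W \<noteq> {}\<close> finW by simp
    obtain f where f: "f ` ?V = W" and f_fibre: "\<forall>a\<in>W. card {x \<in> ?V. f x = a} \<le> n div card W + 1"
      using exists_balanced_surjection[OF finW \<open>W \<noteq> {}\<close> \<open>card W \<le> n\<close>] by blast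
    have k: "card {x \<in> ?V. f x = a} \<le> 129" if "a \<in> W" for a
      by (rule order_trans[OF bspec[OF f_fibre that] fibre])
    let ?F = "F \<inter> pairs W"
    let ?G = "pullback_graph ?V f ?F"
    have pverts: "pverts ?G = ?V" by (simp add: pullback_graph_def)
    have tri: "triangles W ?F = {}"
      using U(2) W(1) by (auto simp: triangles_def)
    have degW: "{u. {u, v} \<in> ?F} = {u \<in> W. {u, v} \<in> F}" if "v \<in> W" for v
      using that edge_endpoints[OF F(1)] by (auto simp: doubleton_in_pairs_iff)
    have deg: "r / 64 \<le> out_degree (with_proj ?G) x \<and> out_degree (with_proj ?G) x \<le> 258 * r"
      if x: "x \<in> ?V" for x
    proof -
      have fx: "f x \<in> W" "f x \<in> ?V" using f x WV by auto
      note bounds = out_degree_pullback_graph_bounds[of ?V W ?F f 129, OF _ finW _ f k x]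
      have "finite {u. {u, f x} \<in> F}"
        using edge_endpoints[OF F(1)] by (rule_tac finite_subset[of _ ?V]) blast+
      then have "card {u. {u, f x} \<in> ?F} \<le> card {u. {u, f x} \<in> F}"
        by (intro card_mono) auto
      then have "129 * real (card {u. {u, f x} \<in> ?F}) \<le> 129 * (2 * r)"
        using F(2)[OF fx(2)] by simp
      moreover have "real (out_degree (with_proj ?G) x) \<le> 129 * real (card {u. {u, f x} \<in> ?F})"
        using bounds(2) by simp
      moreover have "r / 64 \<le> card {u. {u, f x} \<in> ?F}"
        using W(2)[OF fx(1)] by (simp only: degW[OF fx(1)])
      moreover have "card {u. {u, f x} \<in> ?F} \<le> out_degree (with_proj ?G) x"
        using bounds(1) by simp
      ultimately show ?thesis by linarith
    qed
    \<comment> \<open>Positivity, from \<open>n \<ge> 2\<close>, makes the summand 1 in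
      \<open>C\<close> yield a strict inequality.\<close>
    have "ln (real n) > 0" using n by simp
    then have "\<not> has_semi_bipartite_induced_subgraph (with_proj ?G) (C * ln (real n))"
      by (intro not_has_semi_bipartite_pullback_graph[where W = W and k = 129 and c = "72 * ln n"]
            sparse_cross_induced[OF F(3) WV] finW k) (auto simp: C_def f)
    moreover have "pair_graph ?G"
      by (rule pair_graph_pullback_graph[where W = W]) auto
    moreover have "triangle_free (with_proj ?G)"
      using tri by (intro triangle_free_pullback_graph[where W = W]) auto
    moreover have "\<forall>v\<in>pverts ?G. (1/64) * r \<le> out_degree (with_proj ?G) v \<and>
        out_degree (with_proj ?G) v \<le> 258 * r"
      using deg by (simp add: pverts)
    moreover have "card (pverts ?G) = n" by (simp add: pverts)
    ultimately show ?thesis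
      unfolding r_def by blast
  qed
  moreover have "C > 0" by (simp add: C_def)
  ultimately show ?thesis
    by (intro exI[of _ C] exI[of _ "1/64"] exI[of _ 258] conjI exI[of _ "max N 2"] allI impI) simp_all
qed

end
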